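(* Let $\mathbf{A}$ be an IBP$_0$-algebra and $s:A\to\mathscr{L}(\mathbb{R})$ a hyperstate of $\mathbf{A}$. For $a\in A$ put $b_a=\neg\big((\neg(a\cdot a))\cdot(\neg(a\cdot a))\big)\in\mathscr{B}(\mathbf{A})$ and $c_a=a\vee\neg a\in\mathscr{H}(\mathbf{A})$. Then there exist a finitely additive probability measure $p:\mathscr{B}(\mathbf{A})\to[0,1]$, a state $w$ of the prelinear semihoop $\mathscr{H}(\mathbf{A})$, and a positive infinitesimal $\varepsilon$ such that for every $a\in A$, $$s(a)=p(b_a)+\varepsilon\big(w(\neg b_a\vee c_a)-w(b_a\vee c_a)\big).$$
   Context: An MTL-algebra is a bounded commutative integral residuated lattice $\mathbf{A}=(A,\cdot,\to,\wedge,\vee,0,1)$ satisfying $(x\to y)\vee(y\to x)=1$; $\neg x=x\to0$, $x\oplus y=\neg x\to y$, $2x=x\oplus x$, $x^2=x\cdot x$. An IBP$_0$-algebra is an MTL-algebra satisfying $(2x)^2=2(x^2)$ and $\neg\neg x=x$. $\mathscr{B}(\mathbf{A})=\{a\mid a\vee\neg a=1\}$ is the universe of the largest Boolean subalgebra of $\mathbf{A}$; $\mathscr{H}(\mathbf{A})=\{x\mid x>\neg x\}$, which is known to be closed under $\cdot,\to,\wedge,\vee$ and to contain $1$, and forms a prelinear semihoop (a semihoop $(H,\cdot,\to,\wedge,1)$ with $(x\to y)\to z\le((y\to x)\to z)\to z$). It is known that $b_a\in\mathscr{B}(\mathbf{A})$, $c_a\in\mathscr{H}(\mathbf{A})$,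 $a=(b_a\vee\neg c_a)\wedge(\neg b_a\vee c_a)$, and $b\vee c\in\mathscr{H}(\mathbf{A})$ for $b\in\mathscr{B}(\mathbf{A})$, $c\in\mathscr{H}(\mathbf{A})$. $\mathscr{L}(\mathbb{R})$: in a nontrivial ultrapower ${}^*\mathbb{R}$ of $\mathbb{R}$ with a fixed positive infinitesimal $\varepsilon_0$, $\mathscr{L}(\mathbb{R})$ is the MV-subalgebra of ${}^*[0,1]$ (with $a\oplus b=\min(1,a+b)$, $\neg a=1-a$) generated by $[0,1]\cup\{r\varepsilon_0\mid r\in\mathbb{R}\}$; its elements are uniquely $r+\varepsilon_0 t$, $r\in[0,1]$, $t\in\mathbb{R}$ (it is $\Gamma(\mathbb{R}\times_{lex}\mathbb{R},(1,0))$). Arithmetic on values is in ${}^*\mathbb{R}$. A hyperstate is a map $s:A\to\mathscr{L}(\mathbb{R})$ with $s(1)=1$, $s(0)=0$; $s(x\oplus y)+s(x\cdot y)=s(x)+s(y)$; and $s(x)\in[0,1]$ whenever $x\vee\neg x=1$. A state of a prelinear semihoop $\mathbf{H}$ is a map $w:H\to\mathbb{R}^-$ with $w(1)=0$, $w(x\cdot y)=w(x)+w(y)$, and $x\le y\Rightarrow w(x)\le w(y)$. *)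

theory Defs
  imports Complex_Main
begin

section \<open>MTL-algebras and IBP0-algebras\<close>

text \<open>
  The universe of an algebra is the whole type; the constants \<open>0\<close> and \<open>1\<close> are the least and the
  greatest element, and \<open>*\<close> is the monoid operation.
\<close>

class mtl_algebra = lattice + zero + comm_monoid_mult +
  fixes residual :: "'a \<Rightarrow> 'a \<Rightarrow> 'a"  (infixr "\<rightarrowtriangle>" 60)
  assumes zero_least: "0 \<le> x"
    and one_greatest: "x \<le> 1"
    and residuation: "x * y \<le> z \<longleftrightarrow> x \<le> (y \<rightarrowtriangle> z)"
    and prelinearity: "sup (x \<rightarrowtriangle> y) (y \<rightarrowtriangle> x) = 1"
begin

definition neg :: "'a \<Rightarrow> 'a"
  where "neg x = (x \<rightarrowtriangle> 0)"

definition str_disj :: "'a \<Rightarrow> 'a \<Rightarrow> 'a"  (infixl "\<boxplus>" 65)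
  where "x \<boxplus> y = (neg x \<rightarrowtriangle> y)"

definition bool_skeleton :: "'a set"
  where "bool_skeleton = {a. sup a (neg a) = 1}"

definition pos_cone :: "'a set"
  where "pos_cone = {x. neg x < x}"

end

class ibp0_algebra = mtl_algebra +
  assumes bp0: "(x \<boxplus> x)\<^sup>2 = x\<^sup>2 \<boxplus> x\<^sup>2"
    and involutive: "neg (neg x) = x"

definition b_part :: "'a::mtl_algebra \<Rightarrow> 'a"
  where "b_part a = neg (neg (a * a) * neg (a * a))"

definition c_part :: "'a::mtl_algebra \<Rightarrow> 'a"
  where "c_part a = sup a (neg a)"


section \<open>Finitely additive probabilities on the Boolean skeleton\<close>

text \<open>Only the values of \<open>p\<close> on the Boolean skeleton matter.\<close>

definition fin_add_probability :: "('a::mtl_algebra \<Rightarrow> real) \<Rightarrow> bool"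
  where "fin_add_probability p \<longleftrightarrow>
    (\<forall>x\<in>bool_skeleton. 0 \<le> p x \<and> p x \<le> 1) \<and>
    p 1 = 1 \<and>
    (\<forall>x\<in>bool_skeleton. \<forall>y\<in>bool_skeleton. inf x y = 0 \<longrightarrow> p (sup x y) = p x + p y)"


section \<open>Prelinear semihoops and their states\<close>

text \<open>
  A semihoop has a carrier \<open>H\<close>; its order is the one of the meet-semilattice reduct, i.e.
  \<open>x \<sqsubseteq> y\<close> iff \<open>meet x y = x\<close>.
\<close>

locale prelinear_semihoop =
  fixes H :: "'h set"
    and mul :: "'h \<Rightarrow> 'h \<Rightarrow> 'h"  (infixl "\<cdot>" 70)
    and res :: "'h \<Rightarrow> 'h \<Rightarrow> 'h"  (infixr "\<Rrightarrow>" 60)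
    and meet :: "'h \<Rightarrow> 'h \<Rightarrow> 'h"
    and unit :: 'h
  assumes unit_closed: "unit \<in> H"
    and mul_closed: "\<lbrakk>x \<in> H; y \<in> H\<rbrakk> \<Longrightarrow> x \<cdot> y \<in> H"
    and res_closed: "\<lbrakk>x \<in> H; y \<in> H\<rbrakk> \<Longrightarrow> (x \<Rrightarrow> y) \<in> H"
    and meet_closed: "\<lbrakk>x \<in> H; y \<in> H\<rbrakk> \<Longrightarrow> meet x y \<in> H"
    and mul_assoc: "\<lbrakk>x \<in> H; y \<in> H; z \<in> H\<rbrakk> \<Longrightarrow> (x \<cdot> y) \<cdot> z = x \<cdot> (y \<cdot> z)"
    and mul_commute: "\<lbrakk>x \<in> H; y \<in> H\<rbrakk> \<Longrightarrow> x \<cdot> y = y \<cdot> x"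
    and mul_unit: "x \<in> H \<Longrightarrow> unit \<cdot> x = x"
    and meet_assoc: "\<lbrakk>x \<in> H; y \<in> H; z \<in> H\<rbrakk> \<Longrightarrow> meet (meet x y) z = meet x (meet y z)"
    and meet_commute: "\<lbrakk>x \<in> H; y \<in> H\<rbrakk> \<Longrightarrow> meet x y = meet y x"
    and meet_idem: "x \<in> H \<Longrightarrow> meet x x = x"
    and meet_unit: "x \<in> H \<Longrightarrow> meet x unit = x"
    and res_adjoint: "\<lbrakk>x \<in> H; y \<in> H; z \<in> H\<rbrakk> \<Longrightarrow>
      meet (x \<cdot> y) z = x \<cdot> y \<longleftrightarrow> meet x (y \<Rrightarrow> z) = x"
    and prelinear: "\<lbrakk>x \<in> H; y \<in> H; z \<in> H\<rbrakk> \<Longrightarrow>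
      meet ((x \<Rrightarrow> y) \<Rrightarrow> z) (((y \<Rrightarrow> x) \<Rrightarrow> z) \<Rrightarrow> z) = ((x \<Rrightarrow> y) \<Rrightarrow> z)"

text \<open>\<open>\<real>\<^sup>-\<close> is the set of nonpositive reals; only the values of \<open>w\<close> on \<open>H\<close> matter.\<close>

locale semihoop_state = prelinear_semihoop +
  fixes w :: "'a \<Rightarrow> real"
  assumes state_nonpos: "x \<in> H \<Longrightarrow> w x \<le> 0"
    and state_unit: "w unit = 0"
    and state_mul: "\<lbrakk>x \<in> H; y \<in> H\<rbrakk> \<Longrightarrow> w (x \<cdot> y) = w x + w y"
    and state_mono: "\<lbrakk>x \<in> H; y \<in> H; meet x y = x\<rbrakk> \<Longrightarrow> w x \<le> w y"


section \<open>Ultrapowers of the reals\<close>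

text \<open>
  The index type carries an arbitrary free (i.e. nonprincipal) ultrafilter, so a statement about
  all \<open>'i::ultra_index\<close> is a statement about all ultrapowers of the reals over free ultrafilters.
\<close>

class ultra_index =
  fixes ultra :: "'a filter"
  assumes ultra_proper: "ultra \<noteq> bot"
    and ultra_maximal: "eventually P ultra \<or> eventually (\<lambda>i. \<not> P i) ultra"
    and ultra_free: "ultra \<le> cofinite"

text \<open>The class is inhabited.\<close>

lemma ex_free_ultrafilter_nat:
  "\<exists>F :: nat filter. F \<noteq> bot \<and> (\<forall>P. eventually P F \<or> eventually (\<lambda>i. \<not> P i) F) \<and> F \<le> cofinite"
proof -
  define A where "A = {F :: nat filter. F \<noteq> bot \<and> F \<le> cofinite}"
  define R where "R = (\<lambda>F G :: nat filter. G \<le> F)"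
  have cof: "cofinite \<in> A"
    by (auto simp: A_def)
  have "\<exists>M\<in>A. \<forall>X\<in>A. R M X \<longrightarrow> X = M"
  proof (rule predicate_Zorn)
    show "partial_order_on A (relation_of R A)"
      by (rule partial_order_on_relation_ofI) (auto simp: R_def)
    fix C assume C: "C \<in> Chains (relation_of R A)"
    then have sub: "C \<subseteq> A" and tot: "\<And>F G. F \<in> C \<Longrightarrow> G \<in> C \<Longrightarrow> F \<le> G \<or> G \<le> F"
      by (auto simp: Chains_def relation_of_def R_def)
    show "\<exists>U\<in>A. \<forall>F\<in>C. R F U"
    proof (cases "C = {}")
      case True
      with cof show ?thesis by auto
    next
      case False
      have "eventually P (Inf C) \<longleftrightarrow> (\<exists>F\<in>C. eventually P F)" for P
      proof (rule eventually_Inf_base[OF False])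
        fix F G assume "F \<in> C" "G \<in> C"
        then show "\<exists>x\<in>C. x \<le> inf F G"
          using tot[of F G] by auto
      qed
      then have "Inf C \<noteq> bot"
        using sub by (auto simp: A_def trivial_limit_def)
      moreover have "Inf C \<le> cofinite"
        using False sub by (auto simp: A_def intro: Inf_lower2)
      ultimately show ?thesis
        by (auto simp: A_def R_def Inf_lower)
    qed
  qed
  then obtain M where M: "M \<in> A" and min: "\<And>X. X \<in> A \<Longrightarrow> X \<le> M \<Longrightarrow> X = M"
    by (auto simp: R_def)
  have "eventually P M \<or> eventually (\<lambda>i. \<not> P i) M" for P
  proof (cases "eventually P M")
    case nP: False
    define N where "N = inf M (principal {i. \<not> P i})"
    have ev: "eventually Q N \<longleftrightarrow> eventually (\<lambda>i. \<not> P i \<longrightarrow> Q i) M" for Q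
      by (simp add: N_def eventually_inf_principal)
    have "N \<noteq> bot"
      using nP by (auto simp: trivial_limit_def ev)
    moreover have "N \<le> M"
      by (simp add: N_def)
    ultimately have "N = M"
      using M by (intro min) (auto simp: A_def intro: order_trans)
    then show ?thesis
      using ev[of "\<lambda>i. \<not> P i"] by simp
  qed simp
  with M show ?thesis
    by (auto simp: A_def)
qed

instantiation nat :: ultra_index
begin

definition ultra_nat :: "nat filter"
  where "ultra_nat = (SOME F. F \<noteq> bot \<and>
    (\<forall>P. eventually P F \<or> eventually (\<lambda>i. \<not> P i) F) \<and> F \<le> cofinite)"

instance
proof -
  note * = someI_ex[OF ex_free_ultrafilter_nat, folded ultra_nat_def]
  show "OFCLASS(nat, ultra_index_class)"
    by standard (use * in auto)
qed

end

quotient_type (overloaded) 'i hyperreal =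
  "'i::ultra_index \<Rightarrow> real" / "\<lambda>f g. eventually (\<lambda>i. f i = g i) (ultra :: 'i filter)"
  morphisms rep_hyp abs_hyp
proof (rule equivpI)
  show "reflp (\<lambda>f g :: 'i \<Rightarrow> real. eventually (\<lambda>i. f i = g i) ultra)"
    by (simp add: reflp_def)
  show "symp (\<lambda>f g :: 'i \<Rightarrow> real. eventually (\<lambda>i. f i = g i) ultra)"
    by (simp add: symp_def eq_commute)
  show "transp (\<lambda>f g :: 'i \<Rightarrow> real. eventually (\<lambda>i. f i = g i) ultra)"
    by (auto simp: transp_def elim: eventually_elim2)
qed

lemma ultra_not_iff:
  "eventually (\<lambda>i. \<not> P i) ultra \<longleftrightarrow> \<not> eventually P (ultra :: 'i::ultra_index filter)"
proof
  assume "eventually (\<lambda>i. \<not> P i) (ultra :: 'i filter)"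
  then show "\<not> eventually P (ultra :: 'i filter)"
    using ultra_proper[where ?'a = 'i] eventually_conj[of P ultra "\<lambda>i. \<not> P i"]
    by (auto simp: trivial_limit_def)
qed (use ultra_maximal in blast)

lemma ultra_disj_iff:
  "eventually (\<lambda>i. P i \<or> Q i) ultra \<longleftrightarrow>
    eventually P (ultra :: 'i::ultra_index filter) \<or> eventually Q ultra"
proof -
  have "\<not> eventually (\<lambda>i. P i \<or> Q i) ultra \<longleftrightarrow>
      eventually (\<lambda>i. \<not> P i \<and> \<not> Q i) (ultra :: 'i filter)"
    by (simp add: ultra_not_iff[symmetric])
  also have "\<dots> \<longleftrightarrow> \<not> eventually P ultra \<and> \<not> eventually Q ultra"
    by (simp add: eventually_conj_iff ultra_not_iff)
  finally show ?thesis by blast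
qed

instantiation hyperreal :: (ultra_index) linordered_field
begin

lift_definition zero_hyperreal :: "'a hyperreal" is "\<lambda>_. 0" .
lift_definition one_hyperreal :: "'a hyperreal" is "\<lambda>_. 1" .
lift_definition plus_hyperreal :: "'a hyperreal \<Rightarrow> 'a hyperreal \<Rightarrow> 'a hyperreal"
  is "\<lambda>f g i. f i + g i" by (auto elim: eventually_elim2)
lift_definition minus_hyperreal :: "'a hyperreal \<Rightarrow> 'a hyperreal \<Rightarrow> 'a hyperreal"
  is "\<lambda>f g i. f i - g i" by (auto elim: eventually_elim2)
lift_definition times_hyperreal :: "'a hyperreal \<Rightarrow> 'a hyperreal \<Rightarrow> 'a hyperreal"
  is "\<lambda>f g i. f i * g i" by (auto elim: eventually_elim2)
lift_definition divide_hyperreal :: "'a hyperreal \<Rightarrow> 'a hyperreal \<Rightarrow> 'a hyperreal"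
  is "\<lambda>f g i. f i / g i" by (auto elim: eventually_elim2)
lift_definition uminus_hyperreal :: "'a hyperreal \<Rightarrow> 'a hyperreal"
  is "\<lambda>f i. - f i" by (auto elim: eventually_mono)
lift_definition inverse_hyperreal :: "'a hyperreal \<Rightarrow> 'a hyperreal"
  is "\<lambda>f i. inverse (f i)" by (auto elim: eventually_mono)
lift_definition less_eq_hyperreal :: "'a hyperreal \<Rightarrow> 'a hyperreal \<Rightarrow> bool"
  is "\<lambda>f g. eventually (\<lambda>i. f i \<le> g i) ultra"
proof -
  fix f f' g g' :: "'a \<Rightarrow> real"
  assume "eventually (\<lambda>i. f i = f' i) ultra" "eventually (\<lambda>i. g i = g' i) ultra"
  then have "eventually (\<lambda>i. (f i \<le> g i) = (f' i \<le> g' i)) ultra"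
    by eventually_elim simp
  then show "eventually (\<lambda>i. f i \<le> g i) ultra = eventually (\<lambda>i. f' i \<le> g' i) ultra"
    by (rule eventually_subst)
qed
lift_definition less_hyperreal :: "'a hyperreal \<Rightarrow> 'a hyperreal \<Rightarrow> bool"
  is "\<lambda>f g. eventually (\<lambda>i. f i < g i) ultra"
proof -
  fix f f' g g' :: "'a \<Rightarrow> real"
  assume "eventually (\<lambda>i. f i = f' i) ultra" "eventually (\<lambda>i. g i = g' i) ultra"
  then have "eventually (\<lambda>i. (f i < g i) = (f' i < g' i)) ultra"
    by eventually_elim simp
  then show "eventually (\<lambda>i. f i < g i) ultra = eventually (\<lambda>i. f' i < g' i) ultra"
    by (rule eventually_subst)
qed
definition abs_hyperreal :: "'a hyperreal \<Rightarrow> 'a hyperreal"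
  where "abs_hyperreal x = (if x < 0 then - x else x)"
definition sgn_hyperreal :: "'a hyperreal \<Rightarrow> 'a hyperreal"
  where "sgn_hyperreal x = (if x = 0 then 0 else if 0 < x then 1 else - 1)"

instance
proof
  fix a b c :: "'a hyperreal"
  show "a + b + c = a + (b + c)" by transfer (simp add: add.assoc)
  show "a + b = b + a" by transfer (simp add: add.commute)
  show "0 + a = a" by transfer simp
  show "- a + a = 0" by transfer simp
  show "a - b = a + - b" by transfer simp
  show "a + b - a = b" by transfer simp
  show "a - b - c = a - (b + c)" by transfer (simp add: algebra_simps)
  show "0 * a = 0" "a * 0 = 0" by (transfer; simp)+
  show "a * b * c = a * (b * c)" by transfer (simp add: mult.assoc)
  show "a * b = b * a" by transfer (simp add: mult.commute)
  show "1 * a = a" by transfer simp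
  show "(a + b) * c = a * c + b * c" by transfer (simp add: algebra_simps)
  show "(0 :: 'a hyperreal) \<noteq> 1"
    by transfer (simp add: ultra_proper)
  show "inverse a * a = 1" if "a \<noteq> 0"
    using that by transfer (auto simp: ultra_not_iff[symmetric] elim: eventually_mono)
  show "a div b = a * inverse b" by transfer (simp add: divide_inverse)
  show "inverse (0 :: 'a hyperreal) = 0" by transfer simp
  show "a < b \<longleftrightarrow> a \<le> b \<and> \<not> b \<le> a"
    by transfer (auto simp: ultra_not_iff[symmetric] not_le less_imp_le elim: eventually_mono)
  show "a \<le> a" by transfer simp
  show "a \<le> c" if "a \<le> b" "b \<le> c"
    using that by transfer (auto elim: eventually_elim2)
  show "a = b" if "a \<le> b" "b \<le> a"
    using that by transfer (auto elim: eventually_elim2)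
  show "a \<le> b \<or> b \<le> a"
    by transfer (simp add: ultra_disj_iff[symmetric] linear)
  show "c + a \<le> c + b" if "a \<le> b"
    using that by transfer simp
  show "c * a < c * b" if "a < b" "0 < c"
    using that by transfer (auto elim: eventually_elim2)
  show "\<bar>a\<bar> = (if a < 0 then - a else a)" by (rule abs_hyperreal_def)
  show "sgn a = (if a = 0 then 0 else if 0 < a then 1 else - 1)" by (rule sgn_hyperreal_def)
qed

end

lift_definition hyp_real :: "real \<Rightarrow> 'i::ultra_index hyperreal" is "\<lambda>r _. r" .

definition pos_infinitesimal :: "'i::ultra_index hyperreal \<Rightarrow> bool"
  where "pos_infinitesimal e \<longleftrightarrow> 0 < e \<and> (\<forall>r>0. e < hyp_real r)"


section \<open>Hyperstates\<close>

text \<open>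
  The MV-subalgebra of the nonstandard unit interval generated by the real unit interval and
  the multiples \<open>r * e\<close> of the infinitesimal \<open>e\<close>. A negative multiple lies outside the
  nonstandard unit interval and is not a generator. The constants of the MV-algebra are the
  generators \<open>0\<close> and \<open>1\<close>.
\<close>

inductive_set lex_MV :: "'i::ultra_index hyperreal \<Rightarrow> 'i hyperreal set"
  for e :: "'i hyperreal"
  where
    real_unit: "\<lbrakk>0 \<le> r; r \<le> 1\<rbrakk> \<Longrightarrow> hyp_real r \<in> lex_MV e"
  | infinitesimal: "\<lbrakk>0 \<le> hyp_real r * e; hyp_real r * e \<le> 1\<rbrakk> \<Longrightarrow> hyp_real r * e \<in> lex_MV e"
  | oplus: "\<lbrakk>x \<in> lex_MV e; y \<in> lex_MV e\<rbrakk> \<Longrightarrow> min 1 (x + y) \<in> lex_MV e"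
  | complement: "x \<in> lex_MV e \<Longrightarrow> 1 - x \<in> lex_MV e"

definition hyperstate ::
  "'i::ultra_index hyperreal \<Rightarrow> ('a::mtl_algebra \<Rightarrow> 'i hyperreal) \<Rightarrow> bool"
  where "hyperstate e s \<longleftrightarrow>
    (\<forall>x. s x \<in> lex_MV e) \<and>
    s 1 = 1 \<and> s 0 = 0 \<and>
    (\<forall>x y. s (x \<boxplus> y) + s (x * y) = s x + s y) \<and>
    (\<forall>x. sup x (neg x) = 1 \<longrightarrow> s x \<in> hyp_real ` {0..1})"

end

theory Submission
  imports Defs
begin

text \<open>
  On \<open>pos_cone\<close> every sum \<open>h \<boxplus> k\<close> equals \<open>1\<close>, so \<open>s (h * k) = s h + s k - 1\<close>. Boundedness along
  powers then forces the standard part of \<open>s h\<close> to be \<open>1\<close>, and the coefficient of \<open>\<epsilon>0\<close> in \<open>s\<close> is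
  a state there; on the Boolean skeleton the standard part of \<open>s\<close> is the probability. No new
  infinitesimal is needed: \<open>\<epsilon> = \<epsilon>0\<close>. The formula is the identity
  \<open>s a = s b + s (sup (neg b) c) - s (sup b c)\<close>, obtained by splitting \<open>a\<close> along the Boolean
  element \<open>b = b_part a\<close>, because \<open>a * b = c * b\<close> and \<open>a * neg b = neg c * neg b\<close>.
\<close>

section \<open>MTL-algebras\<close>

lemma mtl_mult_right_mono:
  fixes x y z :: "'a::mtl_algebra"
  assumes "x \<le> y" shows "x * z \<le> y * z"
proof -
  have "y \<le> (z \<rightarrowtriangle> y * z)"
    by (simp add: residuation[symmetric])
  with assms have "x \<le> (z \<rightarrowtriangle> y * z)"
    by (rule order_trans)
  then show ?thesis
    by (simp add: residuation)
qed

lemma mtl_mult_mono: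
  fixes x y z u :: "'a::mtl_algebra"
  assumes "x \<le> y" "z \<le> u" shows "x * z \<le> y * u"
  using mtl_mult_right_mono[OF assms(1), of z] mtl_mult_right_mono[OF assms(2), of y]
  by (metis mult.commute order_trans)

lemma mult_le_left: "x * y \<le> (x::'a::mtl_algebra)"
  using mtl_mult_mono[of x x y 1] one_greatest[of y] by simp

lemma mult_le_right: "x * y \<le> (y::'a::mtl_algebra)"
  using mult_le_left[of y x] by (simp add: mult.commute)

text \<open>Multiplication by \<open>x\<close> is left adjoint to
  \<open>x \<rightarrowtriangle> _\<close>, hence preserves joins.\<close>

lemma mult_sup_right: "x * sup y z = sup (x * y) (x * (z::'a::mtl_algebra))"
proof (rule order.antisym)
  have "sup y z \<le> (x \<rightarrowtriangle> sup (x * y) (x * z))"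
    by (intro le_supI) (simp_all add: residuation[symmetric] mult.commute)
  then show "x * sup y z \<le> sup (x * y) (x * z)"
    by (simp only: residuation[symmetric] mult.commute)
qed (auto intro: mtl_mult_mono)

lemma mult_sup_left: "sup y z * x = sup (y * x) (z * (x::'a::mtl_algebra))"
  by (simp add: mult_sup_right mult.commute)

lemma residual_mult_le: "(x \<rightarrowtriangle> y) * x \<le> (y::'a::mtl_algebra)"
  by (simp add: residuation)

lemma residual_eq_one_iff: "(x \<rightarrowtriangle> y) = 1 \<longleftrightarrow> x \<le> (y::'a::mtl_algebra)"
  using residuation[of 1 x y] one_greatest[of "x \<rightarrowtriangle> y"] by (auto intro: order.antisym)

lemma le_zero_iff: "x \<le> 0 \<longleftrightarrow> x = (0::'a::mtl_algebra)"
  using zero_least[of x] by (auto intro: order.antisym)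

lemma mult_zero: "x * 0 = (0::'a::mtl_algebra)" "0 * x = (0::'a::mtl_algebra)"
  by (intro order.antisym mult_le_left mult_le_right zero_least)+

lemma le_neg_iff: "x \<le> neg y \<longleftrightarrow> x * y = (0::'a::mtl_algebra)"
  using residuation[of x y 0] zero_least[of "x * y"]
  by (auto simp: neg_def intro: order.antisym)

lemma mult_neg: "x * neg x = (0::'a::mtl_algebra)"
  using le_neg_iff[of "neg x" x] by (simp add: mult.commute)

lemma neg_antimono: "x \<le> y \<Longrightarrow> neg y \<le> neg (x::'a::mtl_algebra)"
  using mtl_mult_right_mono[of x y "neg y"] mult.commute[of "neg y" x]
  by (simp add: le_neg_iff mult_neg le_zero_iff)

lemma neg_one: "neg 1 = (0::'a::mtl_algebra)"
  using mult_neg[of 1] by simp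

lemma neg_sup: "neg (sup x y) = inf (neg x) (neg (y::'a::mtl_algebra))"
proof (rule order.antisym)
  have "inf (neg x) (neg y) * x = 0" "inf (neg x) (neg y) * y = 0"
    by (simp_all add: le_neg_iff[symmetric])
  then show "inf (neg x) (neg y) \<le> neg (sup x y)"
    by (simp add: le_neg_iff mult_sup_right)
qed (auto intro: neg_antimono)

text \<open>Prelinearity splits \<open>x * y\<close> into two joinands; in each of them a residual
  turns one factor into the other.\<close>

lemma mult_le_sup_squares: "x * y \<le> sup (x * x) (y * (y::'a::mtl_algebra))"
proof -
  have "x * y = x * y * sup (x \<rightarrowtriangle> y) (y \<rightarrowtriangle> x)"
    by (simp add: prelinearity)
  also have "\<dots> = sup (((x \<rightarrowtriangle> y) * x) * y) (((y \<rightarrowtriangle> x) * y) * x)"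
    by (simp add: mult_sup_right ac_simps)
  also have "\<dots> \<le> sup (y * y) (x * x)"
    by (intro sup_mono mtl_mult_right_mono residual_mult_le)
  finally show ?thesis
    by (simp add: sup_commute)
qed

lemma sup_square: "sup x y * sup x y = sup (x * x) (y * (y::'a::mtl_algebra))"
proof (rule order.antisym)
  show "sup x y * sup x y \<le> sup (x * x) (y * y)"
    using mult_le_sup_squares[of x y]
    by (simp add: mult_sup_right mult_sup_left mult.commute)
qed (auto intro: mtl_mult_mono)

section \<open>Involutive algebras and their Boolean elements\<close>

text \<open>Involution makes \<open>\<boxplus>\<close> the De Morgan dual of \<open>*\<close>, hence
  commutative. The proof shows that both sides have the same lower bounds.\<close>

lemma str_disj_eq: "x \<boxplus> y = neg (neg x * neg (y::'a::ibp0_algebra))"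
proof -
  have "z \<le> x \<boxplus> y \<longleftrightarrow> z \<le> neg (neg x * neg y)" for z
  proof -
    have "z \<le> x \<boxplus> y \<longleftrightarrow> z * neg x \<le> neg (neg y)"
      by (simp add: str_disj_def residuation involutive)
    also have "\<dots> \<longleftrightarrow> z \<le> neg (neg x * neg y)"
      by (simp add: le_neg_iff mult.assoc)
    finally show ?thesis .
  qed
  from this[of "x \<boxplus> y"] this[of "neg (neg x * neg y)"] show ?thesis
    by (auto intro: order.antisym)
qed

lemma str_disj_commute: "x \<boxplus> y = y \<boxplus> (x::'a::ibp0_algebra)"
  by (simp add: str_disj_eq mult.commute)

lemma str_disj_eq_one_iff: "x \<boxplus> y = 1 \<longleftrightarrow> neg x \<le> (y::'a::mtl_algebra)"
  by (simp add: str_disj_def residual_eq_one_iff)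

lemma neg_zero: "neg 0 = (1::'a::ibp0_algebra)"
  using involutive[of "1::'a"] by (simp add: neg_one)

lemma neg_inf: "neg (inf x y) = sup (neg x) (neg (y::'a::ibp0_algebra))"
  by (metis neg_sup involutive)

lemma neg_skeleton: "b \<in> bool_skeleton \<Longrightarrow> neg b \<in> (bool_skeleton :: 'a::ibp0_algebra set)"
  by (simp add: bool_skeleton_def involutive sup_commute)

lemma skeleton_split:
  fixes b x :: "'a::mtl_algebra"
  assumes "b \<in> bool_skeleton"
  shows "sup (x * b) (x * neg b) = x"
  using assms by (simp add: bool_skeleton_def mult_sup_right[symmetric])

text \<open>Splitting \<open>inf x b\<close> along \<open>b\<close> leaves only its product with
  \<open>b\<close>, since its product with \<open>neg b\<close> is \<open>0\<close>.\<close>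

lemma skeleton_mult_eq_inf:
  fixes b x :: "'a::mtl_algebra"
  assumes "b \<in> bool_skeleton"
  shows "x * b = inf x b"
proof (rule order.antisym)
  have "inf x b * neg b = 0"
    using mtl_mult_right_mono[of "inf x b" b "neg b"] by (simp add: mult_neg le_zero_iff)
  then have "inf x b = inf x b * b"
    using skeleton_split[OF assms, of "inf x b"] by (simp add: sup.absorb1 zero_least)
  also have "\<dots> \<le> x * b"
    by (rule mtl_mult_right_mono) simp
  finally show "inf x b \<le> x * b" .
qed (simp add: mult_le_left mult_le_right)

lemma skeleton_str_disj_eq_sup:
  fixes b x :: "'a::ibp0_algebra"
  assumes "b \<in> bool_skeleton"
  shows "x \<boxplus> b = sup x b"
  using skeleton_mult_eq_inf[OF neg_skeleton[OF assms], of "neg x"]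
  by (simp add: str_disj_eq neg_inf involutive)

text \<open>The excess of the sum over \<open>x\<close>, measured by its product with
  \<open>neg x\<close>, lies below both \<open>b\<close> and \<open>neg b\<close>, so it
  vanishes.\<close>

lemma skeleton_str_disj_split:
  fixes b x :: "'a::ibp0_algebra"
  assumes "b \<in> bool_skeleton"
  shows "x * b \<boxplus> x * neg b = x"
proof (rule order.antisym)
  let ?z = "x * b \<boxplus> x * neg b"
  have part: "(u \<boxplus> v) * neg x \<le> v" if "u \<le> x" for u v
  proof -
    have "(u \<boxplus> v) * neg x \<le> (u \<boxplus> v) * neg u"
      by (intro mtl_mult_mono order_refl neg_antimono that)
    also have "\<dots> \<le> v"
      by (simp add: str_disj_def residual_mult_le)
    finally show ?thesis .
  qed
  have "?z * neg x \<le> x * neg b"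
    by (intro part mult_le_left)
  moreover have "?z * neg x \<le> x * b"
    unfolding str_disj_commute[of "x * b"] by (intro part mult_le_left)
  ultimately have "?z * neg x \<le> inf b (neg b)"
    by (meson le_inf_iff mult_le_right order_trans)
  also have "\<dots> = 0"
    using skeleton_mult_eq_inf[OF neg_skeleton[OF assms], of b] by (simp add: mult_neg)
  finally have "?z * neg x = 0"
    by (simp add: le_zero_iff)
  then show "?z \<le> x"
    using le_neg_iff[of ?z "neg x"] by (simp add: involutive)
  have *: "v \<le> u \<boxplus> v" for u v :: 'a
    by (simp add: str_disj_def residuation[symmetric] mult_le_left)
  have "sup (x * b) (x * neg b) \<le> ?z"
    using *[of "x * neg b" "x * b"] *[of "x * b" "x * neg b"]
    by (metis str_disj_commute[of "x * b"] le_supI)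
  then show "x \<le> ?z"
    by (simp add: skeleton_split[OF assms])
qed

section \<open>The decomposition in IBP0-algebras\<close>

lemma b_part_eq: "b_part a = a * a \<boxplus> a * (a::'a::ibp0_algebra)"
  by (simp add: b_part_def str_disj_eq)

lemma b_part_eq_square: "b_part a = (a \<boxplus> a) * (a \<boxplus> (a::'a::ibp0_algebra))"
  using bp0[of a] by (simp add: b_part_eq power2_eq_square)

text \<open>Negation exchanges the two sides of the identity \<open>bp0\<close>, and both sides
  equal \<open>b_part a\<close>.\<close>

lemma b_part_neg: "b_part (neg a) = neg (b_part (a::'a::ibp0_algebra))"
proof -
  have "b_part (neg a) = neg ((a \<boxplus> a) * (a \<boxplus> a))"
    by (simp add: b_part_def str_disj_eq involutive)
  then show ?thesis
    by (simp add: b_part_eq_square)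
qed

text \<open>The doubles of \<open>a\<close> and \<open>neg a\<close> are the residuals
  \<open>neg a \<rightarrowtriangle> a\<close> and \<open>a \<rightarrowtriangle> neg a\<close>,
  whose join is \<open>1\<close> by prelinearity; squaring preserves joins.\<close>

lemma b_part_skeleton: "b_part a \<in> (bool_skeleton :: 'a::ibp0_algebra set)"
proof -
  have "sup (a \<boxplus> a) (neg a \<boxplus> neg a) = 1"
    using prelinearity[of "neg a" a] by (simp add: str_disj_def involutive)
  then have "sup (b_part a) (b_part (neg a)) = 1"
    using sup_square[of "a \<boxplus> a" "neg a \<boxplus> neg a"] by (simp add: b_part_eq_square)
  then show ?thesis
    by (simp add: bool_skeleton_def b_part_neg)
qed

text \<open>On the Boolean component \<open>b_part a\<close> the element \<open>a\<close> dominates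
  its negation: \<open>b_part a\<close> lies below \<open>a \<boxplus> a\<close>, which is
  \<open>neg a \<rightarrowtriangle> a\<close>.\<close>

lemma neg_mult_b_part_le: "neg a * b_part a \<le> (a::'a::ibp0_algebra) * b_part a"
proof -
  let ?b = "b_part a"
  have idem: "?b * ?b = ?b"
    using skeleton_mult_eq_inf[OF b_part_skeleton, of "b_part a" a] by simp
  have "?b * neg a \<le> (a \<boxplus> a) * neg a"
    by (simp add: b_part_eq_square mult_le_left mtl_mult_right_mono)
  also have "\<dots> \<le> a"
    by (simp add: str_disj_def residual_mult_le)
  \<comment> \<open>One copy of the idempotent \<open>?b\<close> is spent in reaching
    \<open>a\<close>; the second one remains on both sides.\<close>
  finally have "?b * neg a * ?b \<le> a * ?b"
    by (rule mtl_mult_right_mono)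
  then show ?thesis
    by (metis idem mult.assoc mult.commute)
qed

lemma c_part_mult_b_part: "c_part a * b_part a = (a::'a::ibp0_algebra) * b_part a"
  using neg_mult_b_part_le[of a] by (simp add: c_part_def mult_sup_left sup.absorb1)

text \<open>On the complementary component the roles are reversed: \<open>a\<close> lies below
  \<open>neg a\<close> there, and \<open>neg (c_part a)\<close> is the meet of the two.\<close>

lemma neg_c_part_mult_neg_b_part:
  "neg (c_part a) * neg (b_part a) = (a::'a::ibp0_algebra) * neg (b_part a)"
proof (rule order.antisym)
  let ?d = "neg (b_part a)"
  have d: "?d \<in> bool_skeleton"
    by (intro neg_skeleton b_part_skeleton)
  have "a * ?d \<le> neg a * ?d"
    using neg_mult_b_part_le[of "neg a"] by (simp add: b_part_neg involutive)
  then show "a * ?d \<le> neg (c_part a) * ?d"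
    by (simp add: c_part_def neg_sup skeleton_mult_eq_inf[OF d] involutive le_infI1)
  show "neg (c_part a) * ?d \<le> a * ?d"
    by (simp add: c_part_def neg_sup involutive mtl_mult_right_mono)
qed

section \<open>The positive cone\<close>

text \<open>Strictness is automatic: a fixed point of negation would have double \<open>1\<close>
  and square \<open>0\<close>, so \<open>bp0\<close> would give
  \<open>0 \<boxplus> 0 = 1\<close>.\<close>

lemma pos_cone_iff:
  assumes "(0::'a::ibp0_algebra) \<noteq> 1"
  shows "x \<in> pos_cone \<longleftrightarrow> neg x \<le> (x::'a)"
proof -
  have "neg x \<noteq> x"
  proof
    assume eq: "neg x = x"
    then have "x \<boxplus> x = 1" "x * x = 0"
      using mult_neg[of x] by (simp_all add: str_disj_eq_one_iff)
    then have "0 \<boxplus> 0 = (1::'a)"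
      using bp0[of x] by (simp add: power2_eq_square)
    with assms show False
      by (simp add: str_disj_eq_one_iff neg_zero le_zero_iff)
  qed
  then show ?thesis
    by (auto simp: pos_cone_def less_le)
qed

lemma self_neg_le_upward: "neg x \<le> x \<Longrightarrow> x \<le> y \<Longrightarrow> neg y \<le> (y::'a::mtl_algebra)"
  by (rule order_trans[OF neg_antimono order_trans])

text \<open>The condition on \<open>z\<close> says that \<open>neg z\<close> squares to
  \<open>0\<close>, and squaring distributes over the join of \<open>neg x\<close> and
  \<open>neg y\<close>.\<close>

lemma self_neg_le_inf:
  fixes x y :: "'a::ibp0_algebra"
  assumes "neg x \<le> x" "neg y \<le> y"
  shows "neg (inf x y) \<le> inf x y"
proof -
  have sq: "neg z \<le> z \<longleftrightarrow> neg z * neg z = 0" for z :: 'a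
    using le_neg_iff[of "neg z" "neg z"] by (simp add: involutive)
  show ?thesis
    unfolding sq using assms by (simp add: sq neg_inf sup_square)
qed

lemma self_neg_le_mult:
  fixes x y :: "'a::ibp0_algebra"
  assumes "neg x \<le> x" "neg y \<le> y"
  shows "neg (x * y) \<le> x * y"
proof -
  \<comment> \<open>It suffices to treat the square of the meet, which lies below
    \<open>x * y\<close>; \<open>bp0\<close> speaks only about squares.\<close>
  let ?m = "inf x y"
  have "?m \<boxplus> ?m = 1"
    using self_neg_le_inf[OF assms] by (simp add: str_disj_eq_one_iff)
  then have "neg (?m * ?m) \<le> ?m * ?m"
    using bp0[of ?m] by (simp add: str_disj_eq_one_iff[symmetric] power2_eq_square)
  then show ?thesis
    by (rule self_neg_le_upward) (simp add: mtl_mult_mono)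
qed

text \<open>Here \<open>neg x\<close> is below the negated meet, hence below the meet and below
  \<open>y\<close>.\<close>

lemma self_neg_le_str_disj:
  fixes x y :: "'a::ibp0_algebra"
  assumes "neg x \<le> x" "neg y \<le> y"
  shows "x \<boxplus> y = 1"
  using self_neg_le_inf[OF assms] by (simp add: str_disj_eq_one_iff neg_inf)

lemma self_neg_le_c_part: "neg (c_part a) \<le> c_part (a::'a::ibp0_algebra)"
  by (simp add: c_part_def neg_sup involutive le_infI1)

lemma prelinear_semihoop_pos_cone:
  assumes "(0::'a::ibp0_algebra) \<noteq> 1"
  shows "prelinear_semihoop (pos_cone :: 'a set) (*) (\<rightarrowtriangle>) inf 1"
proof
  note H = pos_cone_iff[OF assms]
  fix x y z :: 'a
  show "1 \<in> (pos_cone :: 'a set)"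
    by (simp add: H neg_one zero_least)
  show "x * y \<in> pos_cone" if "x \<in> pos_cone" "y \<in> pos_cone"
    using that by (simp add: H self_neg_le_mult)
  show "(x \<rightarrowtriangle> y) \<in> pos_cone" if "x \<in> pos_cone" "y \<in> pos_cone"
    using that self_neg_le_upward[of y "x \<rightarrowtriangle> y"]
    by (simp add: H residuation[symmetric] mult_le_left)
  show "inf x y \<in> pos_cone" if "x \<in> pos_cone" "y \<in> pos_cone"
    using that unfolding H by (rule self_neg_le_inf)
  show "inf x 1 = x"
    by (simp add: inf.absorb1 one_greatest)
  show "inf (x * y) z = x * y \<longleftrightarrow> inf x (y \<rightarrowtriangle> z) = x"
    by (simp add: inf.absorb_iff1[symmetric] residuation)
  show "inf ((x \<rightarrowtriangle> y) \<rightarrowtriangle> z) (((y \<rightarrowtriangle> x) \<rightarrowtriangle> z) \<rightarrowtriangle> z) = ((x \<rightarrowtriangle> y) \<rightarrowtriangle> z)"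
  proof -
    let ?u = "(x \<rightarrowtriangle> y) \<rightarrowtriangle> z" and ?v = "(y \<rightarrowtriangle> x) \<rightarrowtriangle> z"
    \<comment> \<open>After inserting a join equal to \<open>1\<close> and distributing, each
      joinand contains a residual next to its own antecedent.\<close>
    have "?u * ?v = ?u * ?v * sup (x \<rightarrowtriangle> y) (y \<rightarrowtriangle> x)"
      by (simp add: prelinearity)
    also have "\<dots> = sup (?v * (?u * (x \<rightarrowtriangle> y))) (?u * (?v * (y \<rightarrowtriangle> x)))"
      by (simp add: mult_sup_right ac_simps)
    also have "\<dots> \<le> z"
    proof (rule le_supI)
      have absorb: "v * ((u \<rightarrowtriangle> z) * u) \<le> z" for u v :: 'a
        using mult_le_right residual_mult_le by (rule order_trans)
      show "?v * (?u * (x \<rightarrowtriangle> y)) \<le> z" "?u * (?v * (y \<rightarrowtriangle> x)) \<le> z"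
        by (rule absorb)+
    qed
    finally show ?thesis
      by (simp add: inf.absorb_iff1[symmetric] residuation)
  qed
qed (simp_all add: ac_simps inf.assoc inf.commute)

section \<open>Values of the form \<open>r + t e\<close>\<close>

lemma hyp_real_add: "hyp_real (x + y) = (hyp_real x + hyp_real y :: 'i::ultra_index hyperreal)"
  by transfer simp

lemma hyp_real_diff: "hyp_real (x - y) = (hyp_real x - hyp_real y :: 'i::ultra_index hyperreal)"
  by transfer simp

lemma hyp_real_uminus: "hyp_real (- x) = (- hyp_real x :: 'i::ultra_index hyperreal)"
  by transfer simp

lemma hyp_real_mult: "hyp_real (x * y) = (hyp_real x * hyp_real y :: 'i::ultra_index hyperreal)"
  by transfer simp

lemma hyp_real_0: "hyp_real 0 = (0 :: 'i::ultra_index hyperreal)"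
  by transfer simp

lemma hyp_real_1: "hyp_real 1 = (1 :: 'i::ultra_index hyperreal)"
  by transfer simp

lemma hyp_real_less_iff: "hyp_real x < (hyp_real y :: 'i::ultra_index hyperreal) \<longleftrightarrow> x < y"
  by transfer (simp add: ultra_proper)

lemma hyp_real_le_iff: "hyp_real x \<le> (hyp_real y :: 'i::ultra_index hyperreal) \<longleftrightarrow> x \<le> y"
  using hyp_real_less_iff[of y x] by (simp add: not_less[symmetric])

text \<open>The order on these values is lexicographic: no real multiple of \<open>e\<close> can
  outweigh a nonzero standard part.\<close>

lemma lex_nonneg_D:
  fixes e :: "'i::ultra_index hyperreal"
  assumes e: "pos_infinitesimal e" and nonneg: "0 \<le> hyp_real r + hyp_real t * e"
  shows "0 \<le> r" and "r = 0 \<Longrightarrow> 0 \<le> t"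
proof -
  have pos: "0 < e" and small: "\<And>q. 0 < q \<Longrightarrow> e < hyp_real q"
    using e by (auto simp: pos_infinitesimal_def)
  show "0 \<le> r"
  proof (rule ccontr)
    assume "\<not> 0 \<le> r"
    \<comment> \<open>A positive bound for \<open>t\<close>, so that the infinitesimal can be
      compared with the positive real \<open>- r / m\<close>.\<close>
    define m where "m = max t 1"
    have m: "t \<le> m" "0 < m"
      by (auto simp: m_def)
    have "hyp_real t * e \<le> hyp_real m * e"
      using pos m by (simp add: hyp_real_le_iff mult_right_mono)
    also have "\<dots> < hyp_real m * hyp_real (- r / m)"
      using small[of "- r / m"] \<open>\<not> 0 \<le> r\<close> m hyp_real_less_iff[of 0 m]
      by (intro mult_strict_left_mono) (auto simp: hyp_real_0 divide_neg_pos)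
    also have "\<dots> = - hyp_real r"
      using m by (simp add: hyp_real_mult[symmetric] hyp_real_uminus[symmetric])
    finally show False
      using nonneg by simp
  qed
  show "0 \<le> t" if "r = 0"
  proof (rule ccontr)
    assume "\<not> 0 \<le> t"
    then have "hyp_real t < (0 :: 'i hyperreal)"
      using hyp_real_less_iff[of t 0, where ?'i = 'i] by (simp add: hyp_real_0)
    then have "hyp_real t * e < 0"
      using pos by (simp add: mult_neg_pos)
    with nonneg that show False
      by (simp add: hyp_real_0)
  qed
qed

lemma lex_eq_D:
  fixes e :: "'i::ultra_index hyperreal"
  assumes e: "pos_infinitesimal e"
    and eq: "hyp_real r + hyp_real t * e = hyp_real r' + hyp_real t' * e"
  shows "r = r' \<and> t = t'"
proof -
  have "0 \<le> hyp_real (r - r') + hyp_real (t - t') * e"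
    "0 \<le> hyp_real (r' - r) + hyp_real (t' - t) * e"
    using eq by (simp_all add: hyp_real_diff algebra_simps)
  from lex_nonneg_D[OF e this(1)] lex_nonneg_D[OF e this(2)] show ?thesis
    by auto
qed

lemma lex_MV_form:
  assumes "x \<in> lex_MV e"
  shows "\<exists>r t. x = hyp_real r + hyp_real t * e"
  using assms
proof induction
  case (real_unit r)
  show ?case
    by (rule exI[of _ r], rule exI[of _ 0]) (simp add: hyp_real_0)
next
  case (infinitesimal r)
  show ?case
    by (rule exI[of _ 0], rule exI[of _ r]) (simp add: hyp_real_0)
next
  case (oplus x y)
  then obtain r t r' t' where xy: "x = hyp_real r + hyp_real t * e"
    "y = hyp_real r' + hyp_real t' * e"
    by blast
  have "x + y = hyp_real (r + r') + hyp_real (t + t') * e"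
    by (simp add: xy hyp_real_add algebra_simps)
  moreover have "1 = hyp_real 1 + hyp_real 0 * e"
    by (simp add: hyp_real_0 hyp_real_1)
  ultimately show ?case
    unfolding min_def by metis
next
  case (complement x)
  then obtain r t where x: "x = hyp_real r + hyp_real t * e"
    by blast
  have "1 - x = hyp_real (1 - r) + hyp_real (- t) * e"
    by (simp add: x hyp_real_diff hyp_real_uminus hyp_real_1 algebra_simps)
  then show ?case
    by blast
qed

lemma lex_MV_bounds:
  assumes "x \<in> lex_MV (e :: 'i::ultra_index hyperreal)"
  shows "0 \<le> x \<and> x \<le> 1"
  using assms
proof induction
  case (real_unit r)
  then show ?case
    using hyp_real_le_iff[of 0 r, where ?'i = 'i] hyp_real_le_iff[of r 1, where ?'i = 'i]
    by (simp add: hyp_real_0 hyp_real_1)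
qed auto

section \<open>Hyperstates\<close>

lemma hyperstateD:
  assumes "hyperstate e s"
  shows "0 \<le> s x" "s x \<le> 1" "s 1 = 1" "s 0 = 0"
    and "s (x \<boxplus> y) + s (x * y) = s x + s y"
    and "b \<in> bool_skeleton \<Longrightarrow> s b \<in> hyp_real ` {0..1}"
  using assms lex_MV_bounds[of "s x" e] by (auto simp: hyperstate_def bool_skeleton_def)

lemma hyperstate_neg:
  fixes s :: "'a::ibp0_algebra \<Rightarrow> 'i::ultra_index hyperreal"
  assumes "hyperstate e s"
  shows "s (neg x) = 1 - s x"
proof -
  have "x \<boxplus> neg x = 1"
    by (simp add: str_disj_eq_one_iff)
  then show ?thesis
    using hyperstateD(5)[OF assms, of x "neg x"]
    by (simp add: hyperstateD(3,4)[OF assms] mult_neg algebra_simps)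
qed

text \<open>If \<open>x \<le> y\<close>, then \<open>neg x \<boxplus> y = 1\<close>, and additivity
  identifies \<open>s y - s x\<close> with a value of \<open>s\<close>.\<close>

lemma hyperstate_mono:
  fixes s :: "'a::ibp0_algebra \<Rightarrow> 'i::ultra_index hyperreal"
  assumes s: "hyperstate e s" and "x \<le> y"
  shows "s x \<le> s y"
proof -
  have "neg x \<boxplus> y = 1"
    using assms by (simp add: str_disj_eq_one_iff involutive)
  then have "s (neg x * y) = s y - s x"
    using hyperstateD(5)[OF s, of "neg x" y]
    by (simp add: hyperstate_neg[OF s] hyperstateD(3)[OF s] algebra_simps)
  then show ?thesis
    using hyperstateD(1)[OF s, of "neg x * y"] by simp
qed

text \<open>The two pieces have product \<open>0\<close> and strong disjunction
  \<open>x\<close>.\<close>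

lemma hyperstate_split:
  fixes s :: "'a::ibp0_algebra \<Rightarrow> 'i::ultra_index hyperreal"
  assumes s: "hyperstate e s" and b: "b \<in> bool_skeleton"
  shows "s (x * b) + s (x * neg b) = s x"
proof -
  have "x * b * (x * neg b) = x * x * (b * neg b)"
    by (simp add: ac_simps)
  then show ?thesis
    using hyperstateD(5)[OF s, of "x * b" "x * neg b"]
    by (simp add: skeleton_str_disj_split[OF b] mult_neg mult_zero hyperstateD(4)[OF s])
qed

lemma hyperstate_sup_skeleton:
  fixes s :: "'a::ibp0_algebra \<Rightarrow> 'i::ultra_index hyperreal"
  assumes s: "hyperstate e s" and b: "b \<in> bool_skeleton"
  shows "s (sup b x) + s (x * b) = s x + s b"
  using hyperstateD(5)[OF s, of x b] by (simp add: skeleton_str_disj_eq_sup[OF b] sup_commute)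

lemma hyperstate_decomposition:
  fixes s :: "'a::ibp0_algebra \<Rightarrow> 'i::ultra_index hyperreal"
  assumes s: "hyperstate e s"
  shows "s a = s (b_part a) + s (sup (neg (b_part a)) (c_part a)) - s (sup (b_part a) (c_part a))"
proof -
  let ?b = "b_part a" and ?c = "c_part a"
  have b: "?b \<in> bool_skeleton" and nb: "neg ?b \<in> bool_skeleton"
    by (intro neg_skeleton b_part_skeleton)+
  have "s (?c * ?b) + s (neg ?c * neg ?b) = s a"
    using hyperstate_split[OF s b, of a]
    by (simp add: c_part_mult_b_part neg_c_part_mult_neg_b_part)
  \<comment> \<open>By De Morgan the join of the two factors is \<open>neg (?c * ?b)\<close>, so
    everything reduces to the values at \<open>?b\<close>, \<open>?c\<close> and
    \<open>?c * ?b\<close>.\<close>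
  moreover have "s (neg ?c * neg ?b) = s (?c * ?b) + s (neg ?c) + s (neg ?b) - 1"
  proof -
    have "sup (neg ?b) (neg ?c) = neg (?c * ?b)"
      by (simp add: skeleton_mult_eq_inf[OF b] neg_inf sup_commute)
    then show ?thesis
      using hyperstate_sup_skeleton[OF s nb, of "neg ?c"]
      by (simp add: hyperstate_neg[OF s] algebra_simps)
  qed
  moreover have "s (?c * ?b) + s (?c * neg ?b) = s ?c"
    by (rule hyperstate_split[OF s b])
  ultimately show ?thesis
    using hyperstate_sup_skeleton[OF s b, of ?c] hyperstate_sup_skeleton[OF s nb, of ?c]
    by (simp add: hyperstate_neg[OF s] algebra_simps)
qed

lemma hyperstate_mult_pos:
  fixes s :: "'a::ibp0_algebra \<Rightarrow> 'i::ultra_index hyperreal"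
  assumes s: "hyperstate e s" and "neg x \<le> x" "neg y \<le> y"
  shows "s (x * y) = s x + s y - 1"
  using hyperstateD(5)[OF s, of x y] self_neg_le_str_disj[OF assms(2,3)]
  by (simp add: hyperstateD(3)[OF s] algebra_simps)

theorem theorem5p7:
  fixes \<epsilon>0 :: "'i::ultra_index hyperreal"
    and s :: "'a::ibp0_algebra \<Rightarrow> 'i hyperreal"
  assumes "pos_infinitesimal \<epsilon>0"
    and "hyperstate \<epsilon>0 s"
  shows "\<exists>(p :: 'a \<Rightarrow> real) (w :: 'a \<Rightarrow> real) (\<epsilon> :: 'i hyperreal).
    fin_add_probability p \<and>
    semihoop_state (pos_cone :: 'a set) (*) (\<rightarrowtriangle>) inf 1 w \<and>
    pos_infinitesimal \<epsilon> \<and>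
    (\<forall>a. s a = hyp_real (p (b_part a)) +
      \<epsilon> * hyp_real (w (sup (neg (b_part a)) (c_part a)) - w (sup (b_part a) (c_part a))))"
proof -
  note e = assms(1) and s = assms(2)
  have "\<exists>r t. s x = hyp_real r + hyp_real t * \<epsilon>0" for x
    using s by (intro lex_MV_form) (simp add: hyperstate_def)
  \<comment> \<open>The two coordinates of \<open>s\<close> are chosen on the whole algebra;
    \<open>eqI\<close> then reads them off from any expression for \<open>s x\<close>.\<close>
  then obtain p w where pw: "\<And>x. s x = hyp_real (p x) + hyp_real (w x) * \<epsilon>0"
    by metis
  have eqI: "p x = r \<and> w x = t" if "s x = hyp_real r + hyp_real t * \<epsilon>0" for x r t
    using lex_eq_D[OF e] that by (simp add: pw)
  \<comment> \<open>The normalisation of \<open>s\<close> rules out the trivial algebra, whose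
    positive cone is empty.\<close>
  have "s 0 \<noteq> s 1"
    by (simp add: hyperstateD(3,4)[OF s])
  then have nontrivial: "(0::'a) \<noteq> 1"
    by metis
  note H = pos_cone_iff[OF nontrivial]
  have one: "p 1 = 1" "w 1 = 0"
    using eqI[of 1 1 0] by (simp_all add: hyperstateD(3)[OF s] hyp_real_0 hyp_real_1)
  have skel: "w b = 0 \<and> 0 \<le> p b \<and> p b \<le> 1" if b: "b \<in> bool_skeleton" for b
  proof -
    obtain r where "s b = hyp_real r" "0 \<le> r" "r \<le> 1"
      using hyperstateD(6)[OF s b] by auto
    with eqI[of b r 0] show ?thesis
      by (simp add: hyp_real_0)
  qed
  have mul: "p (x * y) = p x + p y - 1 \<and> w (x * y) = w x + w y"
    if "neg x \<le> x" "neg y \<le> y" for x y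
    by (rule eqI) (simp add: hyperstate_mult_pos[OF s that] pw[of x] pw[of y]
        hyp_real_add hyp_real_diff
        hyp_real_1 algebra_simps)
  have p_nonneg: "0 \<le> p x" for x
    using lex_nonneg_D(1)[OF e, of "p x" "w x"] hyperstateD(1)[OF s, of x] by (simp add: pw)
  \<comment> \<open>Monotonicity of \<open>s\<close> passes to \<open>w\<close> only between
    elements with equal standard part; on the positive cone this is always so, by
    \<open>p_pos\<close>.\<close>
  have le_D: "p x \<le> p y" "p x = p y \<Longrightarrow> w x \<le> w y" if "s x \<le> s y" for x y
  proof -
    have "0 \<le> hyp_real (p y - p x) + hyp_real (w y - w x) * \<epsilon>0"
      using that by (simp add: pw hyp_real_diff algebra_simps)
    from lex_nonneg_D[OF e this] show "p x \<le> p y" "p x = p y \<Longrightarrow> w x \<le> w y"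
      by simp_all
  qed
  have s_le_1: "s x \<le> s 1" for x
    by (simp add: hyperstateD(2,3)[OF s])
  have p_pos: "p x = 1" if x: "neg x \<le> x" for x
  proof -
    \<comment> \<open>Powers stay in the cone, so \<open>mul\<close> applies again and the defect
      \<open>1 - p x\<close> is multiplied by \<open>n\<close>. Since \<open>p\<close> is
      nonnegative, the Archimedean property excludes a positive defect.\<close>
    have pow: "neg (x ^ n) \<le> x ^ n \<and> p (x ^ n) = 1 - real n * (1 - p x)" for n
    proof (induction n)
      case 0
      show ?case
        by (simp add: neg_one zero_least one)
    next
      case (Suc n)
      then show ?case
        using mul[OF x, of "x ^ n"] self_neg_le_mult[OF x, of "x ^ n"]
        by (simp add: algebra_simps)
    qed
    have bound: "real n * (1 - p x) \<le> 1" for n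
      using pow[of n] p_nonneg[of "x ^ n"] by simp
    have "\<not> p x < 1"
      using reals_Archimedean3[of "1 - p x"] bound by (meson diff_gt_0_iff_gt not_le)
    moreover have "p x \<le> 1"
      using le_D(1)[OF s_le_1, of x] by (simp add: one)
    ultimately show ?thesis
      by simp
  qed
  have prob: "fin_add_probability p"
    unfolding fin_add_probability_def
  proof (intro conjI ballI impI)
    fix x y :: 'a
    assume x: "x \<in> bool_skeleton" and y: "y \<in> bool_skeleton" and "inf x y = 0"
    then have "s (sup x y) = s x + s y"
      \<comment> \<open>Disjointness makes the product term \<open>s 0\<close>, because product and
        meet agree on Boolean elements.\<close>
      using hyperstate_sup_skeleton[OF s x, of y] hyperstateD(4)[OF s]
      by (simp add: skeleton_mult_eq_inf inf_commute add.commute)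
    then have "s (sup x y) = hyp_real (p x + p y) + hyp_real (w x + w y) * \<epsilon>0"
      by (simp add: pw hyp_real_add algebra_simps)
    then show "p (sup x y) = p x + p y"
      using eqI by blast
  qed (simp_all add: skel one)
  interpret prelinear_semihoop "pos_cone :: 'a set" "(*)" "(\<rightarrowtriangle>)" inf 1
    by (rule prelinear_semihoop_pos_cone[OF nontrivial])
  have state: "semihoop_state (pos_cone :: 'a set) (*) (\<rightarrowtriangle>) inf 1 w"
  proof unfold_locales
    show "w 1 = 0"
      by (rule one)
    fix x y :: 'a
    assume x: "x \<in> pos_cone"
    show "w x \<le> 0"
      using le_D(2)[OF s_le_1, of x] x by (simp add: H p_pos one)
    assume y: "y \<in> pos_cone"
    show "w (x * y) = w x + w y"
      using x y mul by (simp add: H)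
    assume "inf x y = x"
    then have "s x \<le> s y"
      by (intro hyperstate_mono[OF s]) (simp add: inf.absorb_iff1)
    then show "w x \<le> w y"
      using x y by (intro le_D(2)) (simp_all add: H p_pos)
  qed
  have "s a = hyp_real (p (b_part a)) +
      \<epsilon>0 * hyp_real (w (sup (neg (b_part a)) (c_part a)) - w (sup (b_part a) (c_part a)))" for a
  proof -
    \<comment> \<open>The cone condition is upward closed, so both joins with
      \<open>c_part a\<close> have standard part \<open>1\<close>; it cancels in the
      difference.\<close>
    have pos: "s (sup u (c_part a)) = 1 + hyp_real (w (sup u (c_part a))) * \<epsilon>0" for u
      using p_pos[OF self_neg_le_upward[OF self_neg_le_c_part, of a "sup u (c_part a)"]]
      by (simp add: pw hyp_real_1)
    have "s (b_part a) = hyp_real (p (b_part a))"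
      by (simp add: pw skel[OF b_part_skeleton] hyp_real_0)
    then show ?thesis
      using hyperstate_decomposition[OF s, of a]
      by (simp only: pos) (simp add: hyp_real_diff algebra_simps)
  qed
  with prob state e show ?thesis
    by blast
qed

end
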